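(* Fix an integer $r\geq 3$, and let $d_{r,1}=3^r-1$ and $c_{r,1}=(4^r-1)-d_{r,1}=4^r-3^r$. Then: (i) The order of $f_{r,1}(x):=1+x+x^{2^r-1}+x^{2^r+1}\in\mathbb{F}_2[x]$ divides $4^r-1$. (ii) The polynomial $h_{r,1}(x):=(1+x^{4^r-1})/f_{r,1}(x)\in\mathbb{F}_2[x]$ satisfies $\ell_1(h_{r,1}(x))=c_{r,1}$. (iii) Hence $\beta_{4^r-1}(f_{r,1})=(c_{r,1},d_{r,1})$, and $f_{r,1}(x)$ is robust.
   Context: For $f\in\mathbb{F}_2[x]$ with $f(0)=1$ and $\deg f\ge 1$, the order $\operatorname{ord}(f)$ is the least integer $D\ge 1$ such that $f(x)\mid 1+x^D$ in $\mathbb{F}_2[x]$. For $g\in\mathbb{F}_2[x]$, $\ell_1(g)$ is the number of monomials of $g$ (terms with coefficient $1$), and for $N\ge\deg g$, $\ell_{0,N}(g)$ is the number of exponents $k\in\{0,1,\dots,N\}$ for which the coefficient of $x^k$ in $g$ is $0$. If $N$ is a positive multiple of $\operatorname{ord}(f)$ and $g(x)=(1+x^N)/f(x)$, then $\beta_N(f)=(\ell_1(g),\ell_{0,N-1}(g))$. With $D=\operatorname{ord}(f)$ and $f^*(x)=(1+x^D)/f(x)$, the polynomial $f$ is called robust if $\ell_1(f^* )>\ell_{0,D-1}(f^* )+1$, equivalently $\ell_1(f^* )>(D+1)/2$. *)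

theory Defs
  imports "HOL-Library.Z2" "HOL-Computational_Algebra.Polynomial"
begin

text \<open>The field with two elements is the type \<open>bit\<close>. Since it is a field, \<open>div\<close> on \<open>bit poly\<close> is
  the quotient of Euclidean division; it is the exact quotient whenever the divisor divides.\<close>

text \<open>Meaningful for \<open>coeff f 0 = 1\<close> and \<open>degree f \<ge> 1\<close>, where such a \<open>D\<close> exists.\<close>
definition poly_ord :: "bit poly \<Rightarrow> nat" where
  "poly_ord f = (LEAST D. 1 \<le> D \<and> f dvd 1 + monom 1 D)"

definition ell1 :: "bit poly \<Rightarrow> nat" where
  "ell1 g = card {k. coeff g k = 1}"

definition ell0 :: "nat \<Rightarrow> bit poly \<Rightarrow> nat" where
  "ell0 N g = card {k \<in> {0..N}. coeff g k = 0}"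

text \<open>Meaningful when \<open>N\<close> is a positive multiple of \<open>poly_ord f\<close>.\<close>
definition beta :: "nat \<Rightarrow> bit poly \<Rightarrow> nat \<times> nat" where
  "beta N f = (let g = (1 + monom 1 N) div f in (ell1 g, ell0 (N - 1) g))"

definition poly_star :: "bit poly \<Rightarrow> bit poly" where
  "poly_star f = (1 + monom 1 (poly_ord f)) div f"

definition robust :: "bit poly \<Rightarrow> bool" where
  "robust f \<longleftrightarrow> ell1 (poly_star f) > ell0 (poly_ord f - 1) (poly_star f) + 1"

definition f_r1 :: "nat \<Rightarrow> bit poly" where
  "f_r1 r = 1 + monom 1 1 + monom 1 (2 ^ r - 1) + monom 1 (2 ^ r + 1)"

definition h_r1 :: "nat \<Rightarrow> bit poly" where
  "h_r1 r = (1 + monom 1 (4 ^ r - 1)) div f_r1 r"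

definition d_r1 :: "nat \<Rightarrow> nat" where
  "d_r1 r = 3 ^ r - 1"

definition c_r1 :: "nat \<Rightarrow> nat" where
  "c_r1 r = (4 ^ r - 1) - d_r1 r"

lemma c_r1_eq: "c_r1 r = 4 ^ r - 3 ^ r"
  by (simp add: c_r1_def d_r1_def)

text \<open>The truncated subtraction in \<^const>\<open>c_r1\<close> never truncates.\<close>
lemma d_r1_le: "d_r1 r \<le> 4 ^ r - 1"
  unfolding d_r1_def by (intro diff_le_mono power_mono) auto

end

theory Submission
  imports Defs
begin

text \<open>Put \<open>q = 2\<^sup>r\<close>, \<open>y = x\<^sup>q\<close> and \<open>u = x + y + x y\<close>. Then \<open>x f = (1 + x) u\<close>, and \<open>u\<^sup>q\<close> is computed
  by the Frobenius map, which gives the closed form \<open>h = (1 + x + \<dots> + x\<^bsup>q\<^sup>2 - 1\<^esup>) + u\<^bsup>q - 1\<^esup>\<close>.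
  Since \<open>u\<^bsup>q - 1\<^esup>\<close> is the product of the trinomials \<open>x\<^bsup>2^b\<^esup> + y\<^bsup>2^b\<^esup> + (x y)\<^bsup>2^b\<^esup>\<close> for \<open>b < r\<close>, it has
  exactly \<open>3\<^sup>r\<close> monomials, all of degree below \<open>q\<^sup>2\<close>. For robustness, \<open>h\<close> consists of
  \<open>m = (q\<^sup>2 - 1) / D\<close> shifted copies of \<open>f\<^sup>*\<close>, and \<open>D \<ge> deg f\<close> forces \<open>m \<le> q - 1\<close>.\<close>

section \<open>Arithmetic in characteristic two\<close>

lemma add_self_bit_poly [simp]: "p + p = (0 :: bit poly)"
proof (rule poly_eqI)
  fix n show "coeff (p + p) n = coeff 0 n"
    by (cases "coeff p n") (simp_all only: coeff_add, simp_all)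
qed

lemma two_bit_poly [simp]: "(2 :: bit poly) = 0"
  using add_self_bit_poly[of 1] by (simp only: one_add_one)

lemma add_self_left_bit_poly [simp]: "p + (p + s) = (s :: bit poly)"
  by (simp only: add.assoc[symmetric] add_self_bit_poly add_0)

lemma add_power_two_power_bit_poly: "(p + s :: bit poly) ^ 2 ^ k = p ^ 2 ^ k + s ^ 2 ^ k"
proof (induction k)
  case (Suc k)
  have sq: "(a + b)\<^sup>2 = a\<^sup>2 + b\<^sup>2" for a b :: "bit poly"
    by (simp add: power2_eq_square algebra_simps)
  show ?case
    by (simp add: power_mult mult.commute[of 2] Suc sq)
qed simp

section \<open>Exponent sets and monomial counts\<close>

lemma coeff_sum_monom_one:
  assumes "finite T"
  shows "coeff (\<Sum>e\<in>T. monom 1 e :: bit poly) k = of_bool (k \<in> T)"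
  using assms by (simp add: coeff_sum sum.delta)

lemma ell1_sum_monom: "finite T \<Longrightarrow> ell1 (\<Sum>e\<in>T. monom 1 e) = card T"
  unfolding ell1_def by (simp add: coeff_sum_monom_one)

lemma support_subset: "{k. coeff (p :: bit poly) k = 1} \<subseteq> {..degree p}"
  using le_degree[of p] by force

lemma finite_support: "finite {k. coeff (p :: bit poly) k = 1}"
  by (rule finite_subset[OF support_subset]) simp

lemma bit_poly_eq_sum_monom: "p = (\<Sum>e\<in>{k. coeff p k = 1}. monom 1 e :: bit poly)"
  by (rule poly_eqI) (simp add: coeff_sum_monom_one finite_support)

text \<open>Quotient and remainder modulo \<open>q\<close> recover the pair. This rules out
  collisions twice below: among the exponents of \<open>x^i * y^j\<close> with
  \<open>y = x^q\<close>, and among copies of a quotient shifted by multiples of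
  \<open>D\<close>.\<close>

lemma inj_on_mixed_radix: "inj_on (\<lambda>(i, j). i + q * j) ({..<q :: nat} \<times> UNIV)"
proof (rule inj_onI; clarsimp)
  fix i j i' j' assume "i < q" "i' < q" "i + q * j = i' + q * j'"
  then have "(i + q * j) mod q = (i' + q * j') mod q" "(i + q * j) div q = (i' + q * j') div q"
    by simp_all
  with \<open>i < q\<close> \<open>i' < q\<close> show "i = i' \<and> j = j'" by simp
qed

lemma ell0_add_ell1:
  assumes "degree g < N"
  shows "ell0 (N - 1) g + ell1 g = N"
proof -
  have "{k. coeff g k = 1} \<subseteq> {..<N}"
    using assms support_subset[of g] by force
  then have "{k \<in> {0..N - 1}. coeff g k = 0} \<union> {k. coeff g k = 1} = {..<N}"
    using assms by auto
  moreover have "{k \<in> {0..N - 1}. coeff g k = 0} \<inter> {k. coeff g k = 1} = {}"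
    by auto
  ultimately show ?thesis
    unfolding ell0_def ell1_def
    by (metis (no_types, lifting) card_Un_disjoint card_lessThan finite_Un finite_lessThan)
qed

text \<open>With \<open>Q = 2^k\<close>, the exponent for \<open>Suc k\<close> is
  \<open>Q + (Q - 1)\<close>, and Frobenius turns the new factor into
  \<open>a^Q + b^Q + a^Q * b^Q\<close>. Its three terms shift \<open>S\<close> by
  \<open>(Q, 0)\<close>, \<open>(0, Q)\<close> and \<open>(Q, Q)\<close>; as \<open>S\<close> lies
  in the box below \<open>Q\<close>, the shifted copies are disjoint and the cardinality
  triples.\<close>

lemma power_trinomial_eq_sum:
  fixes a b :: "bit poly"
  shows "\<exists>S \<subseteq> {..<2 ^ k} \<times> {..<2 ^ k}. card S = 3 ^ k \<and>
    (a + b + a * b) ^ (2 ^ k - 1) = (\<Sum>(i, j)\<in>S. a ^ i * b ^ j)"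
proof (induction k)
  case 0
  show ?case by (rule exI[of _ "{(0, 0)}"]) simp
next
  case (Suc k)
  define Q :: nat where "Q = 2 ^ k"
  from Suc obtain S where S: "S \<subseteq> {..<Q} \<times> {..<Q}" and card: "card S = 3 ^ k"
    and eq: "(a + b + a * b) ^ (Q - 1) = (\<Sum>(i, j)\<in>S. a ^ i * b ^ j)"
    unfolding Q_def by blast
  have fin: "finite S" using S by (rule finite_subset) simp
  define A where "A = (\<lambda>(i, j). (i + Q, j)) ` S"
  define B where "B = (\<lambda>(i, j). (i, j + Q)) ` S"
  define C where "C = (\<lambda>(i, j). (i + Q, j + Q)) ` S"
  have inj: "inj_on (\<lambda>(i, j). (i + Q, j)) S" "inj_on (\<lambda>(i, j). (i, j + Q)) S"
    "inj_on (\<lambda>(i, j). (i + Q, j + Q)) S"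
    by (auto simp: inj_on_def)
  have disj: "A \<inter> B = {}" "(A \<union> B) \<inter> C = {}"
    using S unfolding A_def B_def C_def by auto
  have fins: "finite A" "finite B" "finite C" "finite (A \<union> B)"
    using fin unfolding A_def B_def C_def by auto
  have sumA: "(\<Sum>(i, j)\<in>A. a ^ i * b ^ j) = a ^ Q * (\<Sum>(i, j)\<in>S. a ^ i * b ^ j)"
    unfolding A_def sum.reindex[OF inj(1)] sum_distrib_left
    by (intro sum.cong) (auto simp: power_add algebra_simps)
  have sumB: "(\<Sum>(i, j)\<in>B. a ^ i * b ^ j) = b ^ Q * (\<Sum>(i, j)\<in>S. a ^ i * b ^ j)"
    unfolding B_def sum.reindex[OF inj(2)] sum_distrib_left
    by (intro sum.cong) (auto simp: power_add algebra_simps)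
  have sumC: "(\<Sum>(i, j)\<in>C. a ^ i * b ^ j) = a ^ Q * b ^ Q * (\<Sum>(i, j)\<in>S. a ^ i * b ^ j)"
    unfolding C_def sum.reindex[OF inj(3)] sum_distrib_left
    by (intro sum.cong) (auto simp: power_add algebra_simps)
  have "card (A \<union> B \<union> C) = 3 ^ Suc k"
    using disj fins card inj
    by (simp add: card_Un_disjoint card_image A_def B_def C_def)
  moreover have "A \<union> B \<union> C \<subseteq> {..<2 ^ Suc k} \<times> {..<2 ^ Suc k}"
    using S unfolding A_def B_def C_def Q_def by auto
  moreover have "(a + b + a * b) ^ (2 ^ Suc k - 1) = (\<Sum>(i, j)\<in>A \<union> B \<union> C. a ^ i * b ^ j)"
  proof -
    have "(2 :: nat) ^ Suc k - 1 = Q + (Q - 1)" by (simp add: Q_def)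
    then have "(a + b + a * b) ^ (2 ^ Suc k - 1)
      = (a ^ Q + b ^ Q + a ^ Q * b ^ Q) * (\<Sum>(i, j)\<in>S. a ^ i * b ^ j)"
      by (simp only: power_add eq)
        (simp add: Q_def add_power_two_power_bit_poly power_mult_distrib)
    also have "\<dots> = (\<Sum>(i, j)\<in>A \<union> B \<union> C. a ^ i * b ^ j)"
      using disj fins by (simp add: sum.union_disjoint sumA sumB sumC algebra_simps)
    finally show ?thesis .
  qed
  ultimately show ?case by blast
qed

section \<open>The closed form of the quotient h\<close>

lemma geometric_sum_bit_poly:
  "(1 + monom 1 d) * (\<Sum>t<m. monom 1 (d * t)) = (1 + monom 1 (d * m) :: bit poly)"
proof (induction m)
  case (Suc m)
  then show ?case
    by (simp add: distrib_left algebra_simps mult_monom)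
qed (simp add: monom_eq_1)

lemma
  assumes "r \<ge> 1"
  shows f_r1_ne_0: "f_r1 r \<noteq> 0"
    and degree_f_r1: "degree (f_r1 r) = 2 ^ r + 1"
proof -
  show deg: "degree (f_r1 r) = 2 ^ r + 1"
  proof (rule antisym)
    show "degree (f_r1 r) \<le> 2 ^ r + 1"
      unfolding f_r1_def
      by (intro degree_add_le order.trans[OF degree_monom_le]) auto
    have "coeff (f_r1 r) (2 ^ r + 1) = 1"
      by (simp add: f_r1_def)
    then show "2 ^ r + 1 \<le> degree (f_r1 r)"
      by (intro le_degree) simp
  qed
  then show "f_r1 r \<noteq> 0" by auto
qed

lemma f_r1_mult_eq:
  fixes r :: nat
  defines "x \<equiv> monom 1 1 :: bit poly" and "y \<equiv> monom 1 (2 ^ r) :: bit poly"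
  shows "f_r1 r * ((\<Sum>k<4 ^ r. monom 1 k) + (x + y + x * y) ^ (2 ^ r - 1)) = 1 + monom 1 (4 ^ r - 1)"
proof -
  define u where "u = x + y + x * y"
  define z :: "bit poly" where "z = monom 1 (4 ^ r)"
  have xf: "x * f_r1 r = (1 + x) * u"
  proof -
    have "x * f_r1 r = x + x * x + y + x * x * y"
      by (simp add: f_r1_def x_def y_def algebra_simps mult_monom)
    then show ?thesis by (simp add: u_def algebra_simps)
  qed
  have "x ^ 2 ^ r = y" "y ^ 2 ^ r = z"
    by (simp_all add: x_def y_def z_def monom_power flip: power_mult_distrib)
  then have uq: "u ^ 2 ^ r = y + z + y * z"
    by (simp add: u_def add_power_two_power_bit_poly power_mult_distrib)
  have uu: "u * u ^ (2 ^ r - 1) = u ^ 2 ^ r"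
    by (simp flip: power_Suc)
  have geo: "(1 + x) * (\<Sum>k<4 ^ r. monom 1 k) = 1 + z"
    using geometric_sum_bit_poly[of 1 "4 ^ r"] by (simp add: x_def z_def)
  have "x * (f_r1 r * ((\<Sum>k<4 ^ r. monom 1 k) + u ^ (2 ^ r - 1)))
    = ((1 + x) * (\<Sum>k<4 ^ r. monom 1 k)) * u + (1 + x) * (u * u ^ (2 ^ r - 1))"
    by (simp only: mult.assoc[symmetric] xf) (simp only: algebra_simps)
  also have "\<dots> = (1 + z) * u + (1 + x) * (y + z + y * z)"
    by (simp only: geo uu uq)
  \<comment> \<open>After expansion every monomial except \<open>x\<close> and \<open>z\<close>
    occurs twice and cancels.\<close>
  also have "\<dots> = x + z"
    by (simp add: u_def algebra_simps)
  also have "\<dots> = x * (1 + monom 1 (4 ^ r - 1))"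
    by (simp add: x_def z_def algebra_simps mult_monom)
  \<comment> \<open>The auxiliary nonzero factor \<open>x\<close> is cancelled from both
    sides.\<close>
  finally show ?thesis by (simp add: u_def x_def)
qed

lemma
  assumes "r \<ge> 1"
  shows f_r1_dvd: "f_r1 r dvd 1 + monom 1 (4 ^ r - 1)"
    and ell1_h_r1: "ell1 (h_r1 r) = 4 ^ r - 3 ^ r"
proof -
  define q :: nat where "q = 2 ^ r"
  have qq: "4 ^ r = q * q" by (simp add: q_def flip: power_mult_distrib)
  let ?x = "monom 1 1 :: bit poly" and ?y = "monom 1 q :: bit poly"
  obtain S where S: "S \<subseteq> {..<q} \<times> {..<q}" and card: "card S = 3 ^ r"
    and eq: "(?x + ?y + ?x * ?y) ^ (q - 1) = (\<Sum>(i, j)\<in>S. ?x ^ i * ?y ^ j)"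
    using power_trinomial_eq_sum[of r ?x ?y] unfolding q_def by blast
  \<comment> \<open>Substituting \<open>y = x^q\<close> sends \<open>x^i * y^j\<close> to the
    exponent with base-\<open>q\<close> digits \<open>i\<close> and \<open>j\<close>, so distinct
    pairs stay distinct and all exponents are below \<open>q * q\<close>.\<close>
  define T where "T = (\<lambda>(i, j). i + q * j) ` S"
  have inj: "inj_on (\<lambda>(i, j). i + q * j) S"
    using S by (intro inj_on_subset[OF inj_on_mixed_radix]) auto
  have T: "T \<subseteq> {..<4 ^ r}"
  proof -
    have "i + q * j < q * q" if "i < q" "j < q" for i j
    proof -
      have "i + q * j < q * Suc j" using that by simp
      also have "\<dots> \<le> q * q" using that by (intro mult_le_mono) auto
      finally show ?thesis .
    qed
    then show ?thesis using S by (auto simp: T_def qq)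
  qed
  have "(\<Sum>(i, j)\<in>S. ?x ^ i * ?y ^ j) = (\<Sum>e\<in>T. monom 1 e)"
    unfolding T_def sum.reindex[OF inj]
    by (intro sum.cong) (auto simp: monom_power mult_monom)
  moreover have "(\<Sum>k<4 ^ r. monom 1 k) = (\<Sum>k\<in>{..<4 ^ r} - T. monom 1 k) + (\<Sum>k\<in>T. monom 1 k :: bit poly)"
    using T by (intro sum.subset_diff) auto
  \<comment> \<open>In characteristic two, adding the sum over \<open>T\<close> to the all-ones
    polynomial deletes exactly the exponents in \<open>T\<close>.\<close>
  ultimately have prod: "f_r1 r * (\<Sum>k\<in>{..<4 ^ r} - T. monom 1 k) = 1 + monom 1 (4 ^ r - 1)"
    using f_r1_mult_eq[of r] eq by (simp add: q_def add.assoc)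
  then show "f_r1 r dvd 1 + monom 1 (4 ^ r - 1)"
    by (metis dvd_triv_left)
  have "h_r1 r = (\<Sum>k\<in>{..<4 ^ r} - T. monom 1 k)"
    unfolding h_r1_def prod[symmetric] using f_r1_ne_0[OF assms] by simp
  moreover have "card T = 3 ^ r"
    using card inj by (simp add: T_def card_image)
  ultimately show "ell1 (h_r1 r) = 4 ^ r - 3 ^ r"
    using T by (simp add: ell1_sum_monom card_Diff_subset finite_subset)
qed

section \<open>Orders and quotients of 1 + x^n\<close>

lemma degree_one_plus_monom: "n \<ge> 1 \<Longrightarrow> degree (1 + monom 1 n :: bit poly) = n"
  by (simp add: degree_add_eq_right degree_monom_eq)

lemma degree_quotient:
  fixes f :: "bit poly"
  assumes "f dvd 1 + monom 1 n" "n \<ge> 1"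
  shows "degree ((1 + monom 1 n) div f) + degree f = n"
proof -
  have eq: "f * ((1 + monom 1 n) div f) = 1 + monom 1 n"
    using assms by simp
  moreover have "(1 + monom 1 n :: bit poly) \<noteq> 0"
    using degree_one_plus_monom[OF assms(2)] assms(2) by force
  ultimately show ?thesis
    using degree_mult_eq[of f "(1 + monom 1 n) div f"] degree_one_plus_monom[OF assms(2)]
    by (metis add.commute mult_eq_0_iff)
qed

text \<open>The exponent \<open>n\<close> witnesses that the \<open>LEAST\<close> in
  \<open>poly_ord\<close> is attained. For \<open>s = n mod D\<close>, \<open>f\<close> divides
  \<open>x^s * (1 + x^(n - s)) = x^s + x^n\<close>, hence also \<open>1 + x^s\<close>, and
  minimality of \<open>D\<close> forces \<open>s = 0\<close>.\<close>

lemma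
  assumes "f dvd 1 + monom 1 n" "n \<ge> 1"
  shows poly_ord_ge_1: "poly_ord f \<ge> 1"
    and dvd_poly_ord: "f dvd 1 + monom 1 (poly_ord f)"
    and poly_ord_dvd: "poly_ord f dvd n"
proof -
  have *: "1 \<le> poly_ord f \<and> f dvd 1 + monom 1 (poly_ord f)"
    unfolding poly_ord_def by (rule LeastI[of _ n]) (use assms in simp)
  then show D: "poly_ord f \<ge> 1" "f dvd 1 + monom 1 (poly_ord f)" by auto
  define D where "D = poly_ord f"
  define s where "s = n mod D"
  have "f dvd 1 + monom 1 (D * (n div D))"
    using D(2) geometric_sum_bit_poly[of D "n div D"] unfolding D_def by (metis dvd_mult2)
  then have "f dvd monom 1 s * (1 + monom 1 (D * (n div D)))" by (rule dvd_mult)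
  also have "monom 1 s * (1 + monom 1 (D * (n div D))) = monom 1 s + (monom 1 n :: bit poly)"
    by (simp add: distrib_left mult_monom s_def)
  finally have "f dvd (1 + monom 1 n) + (monom 1 s + monom 1 n)"
    using assms(1) by (rule dvd_add[rotated])
  then have "f dvd 1 + monom 1 s" by (simp add: algebra_simps)
  moreover have "s < D" using D(1) by (simp add: s_def D_def)
  ultimately have "s = 0"
    using not_less_Least[of s "\<lambda>D. 1 \<le> D \<and> f dvd 1 + monom 1 D"]
    unfolding D_def poly_ord_def by fastforce
  then show "poly_ord f dvd n" by (simp add: s_def D_def dvd_eq_mod_eq_0)
qed

text \<open>Since \<open>f\<close> is not constant, the quotient for \<open>D\<close> has degree
  below \<open>D\<close>. Its translates by \<open>0, D, ..., D * (m - 1)\<close> therefore have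
  disjoint supports, and nothing cancels in their sum.\<close>

lemma ell1_quotient_multiple:
  fixes f :: "bit poly"
  assumes dvd: "f dvd 1 + monom 1 D" and D: "D \<ge> 1" and f: "degree f \<ge> 1"
  shows "ell1 ((1 + monom 1 (D * m)) div f) = m * ell1 ((1 + monom 1 D) div f)"
proof -
  define g where "g = (1 + monom 1 D) div f"
  define A where "A = {k. coeff g k = 1}"
  have "degree g < D"
    using degree_quotient[OF dvd D] f by (simp add: g_def)
  then have A: "A \<subseteq> {..<D}"
    using support_subset[of g] by (force simp: A_def)
  have g: "g = (\<Sum>s\<in>A. monom 1 s)"
    unfolding A_def by (rule bit_poly_eq_sum_monom)
  define T where "T = (\<lambda>(i, j). i + D * j) ` (A \<times> {..<m})"
  have inj: "inj_on (\<lambda>(i, j). i + D * j) (A \<times> {..<m})"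
    using A by (intro inj_on_subset[OF inj_on_mixed_radix]) auto
  have finA: "finite A" using finite_support by (simp add: A_def)
  have "f * g = 1 + monom 1 D" using dvd by (simp add: g_def)
  then have "1 + monom 1 (D * m) = f * (g * (\<Sum>t<m. monom 1 (D * t)))"
    using geometric_sum_bit_poly[of D m] by (metis mult.assoc)
  then have "(1 + monom 1 (D * m)) div f = g * (\<Sum>t<m. monom 1 (D * t))"
    using f by (metis degree_0 nonzero_mult_div_cancel_left not_one_le_zero)
  also have "\<dots> = (\<Sum>s\<in>A. \<Sum>t<m. monom 1 (s + D * t))"
    by (simp add: g sum_product mult_monom)
  also have "\<dots> = (\<Sum>e\<in>T. monom 1 e)"
    unfolding T_def sum.reindex[OF inj] sum.cartesian_product
    by (intro sum.cong) auto
  finally have "ell1 ((1 + monom 1 (D * m)) div f) = card T"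
    using finA by (simp add: ell1_sum_monom T_def)
  also have "\<dots> = m * card A"
    using inj by (simp add: T_def card_image card_cartesian_product)
  finally show ?thesis by (simp add: A_def g_def ell1_def)
qed

text \<open>The numerical core of robustness. It already fails at \<open>r = 2\<close>, where the
  sides are 22 and 18.\<close>

lemma four_power_gt: "2 * 3 ^ r + 2 ^ r < 4 ^ r + (2 :: nat)" if "r \<ge> 3"
  using that
proof (induction r rule: dec_induct)
  case (step r)
  have "(1 :: nat) \<le> 4 ^ r" "(1 :: nat) \<le> 2 ^ r" by simp_all
  with step.IH show ?case unfolding power_Suc by linarith
qed simp

theorem theorem2p8:
  fixes r :: nat
  assumes "r \<ge> 3"
  shows "poly_ord (f_r1 r) dvd 4 ^ r - 1
    \<and> f_r1 r dvd 1 + monom 1 (4 ^ r - 1)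
    \<and> ell1 (h_r1 r) = c_r1 r
    \<and> beta (4 ^ r - 1) (f_r1 r) = (c_r1 r, d_r1 r)
    \<and> robust (f_r1 r)"
proof -
  define f where "f = f_r1 r"
  define N :: nat where "N = 4 ^ r - 1"
  define D where "D = poly_ord f"
  define g where "g = (1 + monom 1 D) div f"
  have r: "r \<ge> 1" using assms by simp
  have "(4 :: nat) ^ 1 \<le> 4 ^ r" using r by (intro power_increasing) auto
  then have N: "N \<ge> 1" by (simp add: N_def)
  have deg: "degree f = 2 ^ r + 1" using degree_f_r1[OF r] by (simp add: f_def)
  have dvd: "f dvd 1 + monom 1 N" using f_r1_dvd[OF r] by (simp add: f_def N_def)
  have D: "D \<ge> 1" "f dvd 1 + monom 1 D" "D dvd N"
    using poly_ord_ge_1[OF dvd N] dvd_poly_ord[OF dvd N] poly_ord_dvd[OF dvd N]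
    by (simp_all add: D_def)
  then obtain m where m: "N = D * m" by blast
  have h: "h_r1 r = (1 + monom 1 N) div f" by (simp add: h_r1_def f_def N_def)
  have c: "ell1 (h_r1 r) = c_r1 r" by (simp add: ell1_h_r1[OF r] c_r1_eq)
  have "degree (h_r1 r) < N" using degree_quotient[OF dvd N] deg by (simp add: h)
  then have "ell0 (N - 1) (h_r1 r) = d_r1 r"
    using ell0_add_ell1[of "h_r1 r" N] c d_r1_le[of r] by (simp add: N_def c_r1_def)
  with c have beta: "beta N f = (c_r1 r, d_r1 r)"
    by (simp add: beta_def Let_def h)
  have g: "degree g + degree f = D"
    using degree_quotient[OF D(2,1)] by (simp add: g_def)
  then have "ell0 (D - 1) g + ell1 g = D"
    using deg by (intro ell0_add_ell1) simp
  \<comment> \<open>As \<open>ell0\<close> and \<open>ell1\<close> of \<open>g\<close> add up to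
    \<open>D\<close>, this is the robustness inequality.\<close>
  moreover have "2 * ell1 g > D + 1"
  proof (rule ccontr)
    assume "\<not> 2 * ell1 g > D + 1"
    \<comment> \<open>Scaling by \<open>m\<close> trades the unknown count for \<open>g\<close> and
      the unknown \<open>D\<close> for the known count for \<open>h_r1 r\<close> and
      \<open>N\<close>, at the cost of an error term \<open>m\<close>.\<close>
    then have "m * (2 * ell1 g) \<le> m * (D + 1)" by (intro mult_le_mono) auto
    moreover have "m * ell1 g = 4 ^ r - 3 ^ r"
      using ell1_quotient_multiple[OF D(2,1), of m] deg c by (simp add: h m g_def c_r1_eq)
    ultimately have "2 * (4 ^ r - 3 ^ r) \<le> N + m"
      by (simp add: m algebra_simps)
    \<comment> \<open>Here \<open>m * D = N = (2^r - 1) * (2^r + 1)\<close>, and the second factor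
      is the degree of \<open>f\<close>, a lower bound for \<open>D\<close>.\<close>
    moreover have "m \<le> 2 ^ r - 1"
    proof -
      have "2 ^ r + 1 \<le> D" using g deg by linarith
      then have "m * (2 ^ r + 1) \<le> m * D" by (rule mult_le_mono2)
      also have "m * D = (2 ^ r - 1) * (2 ^ r + 1)"
        by (simp add: N_def algebra_simps flip: m power_mult_distrib)
      finally show ?thesis by (simp only: mult_le_cancel2)
    qed
    moreover have "(3 :: nat) ^ r \<le> 4 ^ r" "(1 :: nat) \<le> 2 ^ r"
      by (auto intro: power_mono)
    ultimately show False
      using four_power_gt[OF assms] N unfolding N_def by linarith
  qed
  ultimately have "robust f"
    by (simp add: robust_def poly_star_def flip: D_def g_def)
  with D(3) dvd c beta show ?thesis by (simp add: D_def f_def N_def)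
qed

end
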